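(* Let $G$ be a connected, well-edge-dominated graph containing exactly one triangle $xyz$. If $G-N_e[xy]$ contains exactly one nontrivial component and each of $x,y,z$ has degree at least $3$ in $G$, then $G=Cr$.
   Context: All graphs are simple and finite. A set $F$ of edges of $G$ is an edge dominating set if every edge of $G$ is in $F$ or shares an endpoint with an edge of $F$. $G$ is well-edge-dominated if all minimal (with respect to inclusion) edge dominating sets of $G$ have the same cardinality. A triangle is a subgraph isomorphic to $K_3$. $G-N_e[xy]$ denotes the graph obtained from $G$ by deleting $x$ and $y$ (and all incident edges). A graph is nontrivial if it has at least two vertices. The crystal graph $Cr$ has vertices $t_1,t_2,t_3,u_1,u_2,u_3,u_4$ and edges $t_1t_2,t_2t_3,t_3t_1,u_1u_2,u_2u_3,u_3u_4,u_4u_1,t_1u_2,t_2u_1,t_3u_4$; equality is up to isomorphism. *)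

theory Defs
  imports Main
begin

record 'a graph =
  verts :: "'a set"
  edges :: "'a set set"

definition simple_graph :: "'a graph \<Rightarrow> bool" where
  "simple_graph G \<longleftrightarrow> finite (verts G) \<and> (\<forall>e \<in> edges G. e \<subseteq> verts G \<and> card e = 2)"

definition adj :: "'a graph \<Rightarrow> 'a \<Rightarrow> 'a \<Rightarrow> bool" where
  "adj G u v \<longleftrightarrow> {u, v} \<in> edges G"

definition degree :: "'a graph \<Rightarrow> 'a \<Rightarrow> nat" where
  "degree G v = card {u. adj G v u}"

definition subgraph :: "'a graph \<Rightarrow> 'a graph \<Rightarrow> bool" where
  "subgraph H G \<longleftrightarrow> simple_graph H \<and> verts H \<subseteq> verts G \<and> edges H \<subseteq> edges G"

definition isomorphic :: "'a graph \<Rightarrow> 'b graph \<Rightarrow> bool" where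
  "isomorphic G H \<longleftrightarrow> (\<exists>f. bij_betw f (verts G) (verts H) \<and>
     (\<forall>u \<in> verts G. \<forall>v \<in> verts G. adj G u v \<longleftrightarrow> adj H (f u) (f v)))"

definition complete_graph :: "nat \<Rightarrow> nat graph" where
  "complete_graph n = \<lparr>verts = {..<n}, edges = {{i, j} | i j. i < n \<and> j < n \<and> i \<noteq> j}\<rparr>"

definition connected :: "'a graph \<Rightarrow> bool" where
  "connected G \<longleftrightarrow> verts G \<noteq> {} \<and> (\<forall>u \<in> verts G. \<forall>v \<in> verts G. (adj G)\<^sup>*\<^sup>* u v)"

definition component :: "'a graph \<Rightarrow> 'a graph \<Rightarrow> bool" where
  "component C G \<longleftrightarrow> subgraph C G \<and> connected C \<and>
     (\<forall>D. subgraph D G \<and> connected D \<and> subgraph C D \<longrightarrow> D = C)"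

definition nontrivial :: "'a graph \<Rightarrow> bool" where
  "nontrivial G \<longleftrightarrow> card (verts G) \<ge> 2"

definition delete_verts :: "'a graph \<Rightarrow> 'a set \<Rightarrow> 'a graph" where
  "delete_verts G S = \<lparr>verts = verts G - S, edges = {e \<in> edges G. e \<inter> S = {}}\<rparr>"

definition triangle :: "'a graph \<Rightarrow> 'a graph \<Rightarrow> bool" where
  "triangle T G \<longleftrightarrow> subgraph T G \<and> isomorphic T (complete_graph 3)"

definition edge_dominating :: "'a graph \<Rightarrow> 'a set set \<Rightarrow> bool" where
  "edge_dominating G F \<longleftrightarrow> F \<subseteq> edges G \<and> (\<forall>e \<in> edges G. e \<in> F \<or> (\<exists>f \<in> F. e \<inter> f \<noteq> {}))"

definition minimal_edge_dominating :: "'a graph \<Rightarrow> 'a set set \<Rightarrow> bool" where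
  "minimal_edge_dominating G F \<longleftrightarrow>
     edge_dominating G F \<and> (\<forall>F'. F' \<subset> F \<longrightarrow> \<not> edge_dominating G F')"

definition well_edge_dominated :: "'a graph \<Rightarrow> bool" where
  "well_edge_dominated G \<longleftrightarrow>
     (\<forall>F F'. minimal_edge_dominating G F \<and> minimal_edge_dominating G F' \<longrightarrow> card F = card F')"

datatype crystal_vertex = T1 | T2 | T3 | U1 | U2 | U3 | U4

definition crystal :: "crystal_vertex graph" where
  "crystal = \<lparr>verts = UNIV,
     edges = {{T1, T2}, {T2, T3}, {T3, T1},
              {U1, U2}, {U2, U3}, {U3, U4}, {U4, U1},
              {T1, U2}, {T2, U1}, {T3, U4}}\<rparr>"

end

theory Submission
  imports Defs
begin

text \<open>
  Every maximal matching is a minimal edge dominating set, so all maximal matchings leave the same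
  number \<open>d\<close> of vertices uncovered, and this survives the deletion of the vertices of a matching.
  Let \<open>R\<close> be \<open>G\<close> without the triangle. Comparing the matchings of \<open>R\<close> extended by the three edges
  of the triangle shows that every maximal matching of \<open>R\<close> covers the neighbours of \<open>x\<close>, \<open>y\<close>, \<open>z\<close>.
  The component hypothesis says that every vertex of \<open>R\<close> is joined inside \<open>R\<close> to a neighbour of
  \<open>z\<close>; augmenting path arguments then show that every maximal matching of \<open>R\<close> is perfect, so
  \<open>d = 1\<close> and every path on four vertices in \<open>R\<close> closes to a four-cycle. Finally, a matching
  together with a star of degree four is a minimal edge dominating set of the wrong size
  whenever \<open>G\<close> reduces to a seven-vertex graph of a certain shape, which leaves only the crystal.
\<close>

section \<open>Perfectly matchable vertex sets\<close>

text \<open>Only the set of vertices covered by a matching enters the counting, so matchings are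
  represented by these sets. In a simple graph \<open>u\<close> and \<open>v\<close> are distinct,
  as there are no loops.\<close>

inductive matchable :: "'a graph \<Rightarrow> 'a set \<Rightarrow> bool" for G where
  empty: "matchable G {}"
| insert: "matchable G W \<Longrightarrow> adj G u v \<Longrightarrow> u \<notin> W \<Longrightarrow> v \<notin> W \<Longrightarrow> matchable G (insert u (insert v W))"

definition independent :: "'a graph \<Rightarrow> 'a set \<Rightarrow> bool" where
  "independent G U \<longleftrightarrow> (\<forall>u\<in>U. \<forall>v\<in>U. \<not> adj G u v)"

text \<open>Equimatchability of the subgraph induced by \<open>S\<close>, phrased through the number \<open>d\<close> of vertices
  that a maximal matching leaves uncovered.\<close>

definition equimatchable :: "'a graph \<Rightarrow> 'a set \<Rightarrow> nat \<Rightarrow> bool" where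
  "equimatchable G S d \<longleftrightarrow> (\<forall>U. U \<subseteq> S \<and> independent G U \<and> matchable G (S - U) \<longrightarrow> card U = d)"

lemma adj_sym: "adj G u v \<Longrightarrow> adj G v u"
  by (simp add: adj_def insert_commute)

lemma matchable_pair: "adj G u v \<Longrightarrow> matchable G {u, v}"
  using matchable.insert[OF matchable.empty, of G u v] by simp

lemma matchable_two_edges:
  "adj G a b \<Longrightarrow> adj G p q \<Longrightarrow> a \<notin> {p, q} \<Longrightarrow> b \<notin> {p, q} \<Longrightarrow> matchable G {a, b, p, q}"
  using matchable.insert[OF matchable_pair[of G p q]] by simp

lemma matchable_Un:
  assumes "matchable G A" "matchable G B" "A \<inter> B = {}"
  shows "matchable G (A \<union> B)"
  using assms by induction (auto intro: matchable.intros)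

lemma matchable_finite: "matchable G W \<Longrightarrow> finite W"
  by (induction rule: matchable.induct) auto

text \<open>Elimination rule for a matching known only by its vertex set: it recovers the edge at
  \<open>w\<close> and the matching that remains without it.\<close>

lemma matchable_partner:
  assumes "matchable G W" "w \<in> W"
  obtains w' where "w' \<in> W" "adj G w w'" "matchable G (W - {w, w'})"
  using assms
proof (induction arbitrary: thesis rule: matchable.induct)
  case (insert W u v)
  show ?case
  proof (cases "w \<in> {u, v}")
    case True
    have "insert u (insert v W) - {u, v} = W" using insert.hyps by auto
    then show ?thesis using True insert.prems(1)[of u] insert.prems(1)[of v] insert.hyps adj_sym
      by (metis insertE insertI1 insertI2 insert_commute singletonD)
  next
    case False
    then obtain w' where w': "w' \<in> W" "adj G w w'" "matchable G (W - {w, w'})"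
      using insert.IH insert.prems by auto
    have "insert u (insert v W) - {w, w'} = insert u (insert v (W - {w, w'}))"
      using False w'(1) insert.hyps by auto
    then show ?thesis using insert.prems(1)[of w'] w' insert.hyps
      by (simp add: matchable.insert)
  qed
qed auto

text \<open>Greedy choice: remove the two ends of an edge as long as there is one.\<close>

lemma maximal_matching_exists:
  assumes "finite T" "\<And>v. \<not> adj G v v"
  obtains U where "U \<subseteq> T" "independent G U" "matchable G (T - U)"
  using assms(1)
proof (induction "card T" arbitrary: T thesis rule: less_induct)
  case less
  show ?case
  proof (cases "independent G T")
    case True
    then show ?thesis using less.prems(1)[of T] by (simp add: matchable.empty)
  next
    case False
    then obtain u v where uv: "u \<in> T" "v \<in> T" "adj G u v" unfolding independent_def by auto
    then have "card (T - {u, v}) < card T" using less.prems(2) by (auto intro: psubset_card_mono)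
    then obtain U where U: "U \<subseteq> T - {u, v}" "independent G U" "matchable G (T - {u, v} - U)"
      using less.hyps less.prems(2) by (metis finite_Diff)
    have "T - U = insert u (insert v (T - {u, v} - U))" using uv U(1) by auto
    then have "matchable G (T - U)" using U uv by (simp add: matchable.insert)
    then show ?thesis using less.prems(1)[of U] U by auto
  qed
qed

section \<open>Edge dominating sets from matchings and stars\<close>

lemma simple_delete_verts: "simple_graph G \<Longrightarrow> simple_graph (delete_verts G S)"
  by (auto simp: simple_graph_def delete_verts_def)

lemma adj_delete_verts: "adj (delete_verts G S) u v \<longleftrightarrow> adj G u v \<and> u \<notin> S \<and> v \<notin> S"
  by (auto simp: adj_def delete_verts_def)

lemma adj_irrefl: "simple_graph G \<Longrightarrow> \<not> adj G v v"
  by (auto simp: adj_def simple_graph_def)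

lemma adj_verts: "simple_graph G \<Longrightarrow> adj G u v \<Longrightarrow> u \<in> verts G \<and> v \<in> verts G"
  by (auto simp: adj_def simple_graph_def)

lemma finite_edges: "simple_graph G \<Longrightarrow> finite (edges G)"
  by (rule finite_subset[of _ "Pow (verts G)"]) (auto simp: simple_graph_def)

lemma edge_cases:
  assumes "simple_graph G" "e \<in> edges G"
  obtains u v where "e = {u, v}" "u \<noteq> v" "adj G u v"
  using assms by (auto simp: adj_def simple_graph_def card_2_iff)

text \<open>All edges of \<open>F\<close> avoid \<open>u\<close> and \<open>v\<close>, so among the
  chosen edges only \<open>{u, v}\<close> dominates \<open>{u, v}\<close>. It is thus indispensable,
  and any saving in \<open>insert {u, v} F\<close> would be a saving in \<open>F\<close>.\<close>

lemma minimal_edge_dominating_insert: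
  assumes "adj G u v"
    and F: "minimal_edge_dominating (delete_verts G {u, v}) F"
  shows "minimal_edge_dominating G (insert {u, v} F)" "{u, v} \<notin> F"
proof -
  have sub: "F \<subseteq> {e \<in> edges G. e \<inter> {u, v} = {}}"
    using F by (simp add: minimal_edge_dominating_def edge_dominating_def delete_verts_def)
  show nin: "{u, v} \<notin> F" using sub by auto
  have dom: "e \<in> F \<or> (\<exists>f\<in>F. e \<inter> f \<noteq> {})" if "e \<in> edges G" "e \<inter> {u, v} = {}" for e
    using F that by (simp add: minimal_edge_dominating_def edge_dominating_def delete_verts_def)
  have "edge_dominating G (insert {u, v} F)"
    unfolding edge_dominating_def
  proof (intro conjI ballI)
    show "insert {u, v} F \<subseteq> edges G" using sub assms(1) by (auto simp: adj_def)
    show "e \<in> insert {u, v} F \<or> (\<exists>f\<in>insert {u, v} F. e \<inter> f \<noteq> {})" if "e \<in> edges G" for e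
    proof (cases "e \<inter> {u, v} = {}")
      case True
      then show ?thesis using dom[OF that] by blast
    next
      case False
      then show ?thesis by simp
    qed
  qed
  moreover have "\<not> edge_dominating G F'" if F': "F' \<subset> insert {u, v} F" for F'
  proof
    assume D: "edge_dominating G F'"
    have "{u, v} \<in> F'"
    proof (rule ccontr)
      assume "{u, v} \<notin> F'"
      then obtain f where f: "f \<in> F'" "{u, v} \<inter> f \<noteq> {}"
        using D assms(1) unfolding edge_dominating_def adj_def by auto
      then have "f \<in> F" using F' \<open>{u, v} \<notin> F'\<close> by auto
      then show False using sub f(2) by auto
    qed
    then have psub: "F' - {{u, v}} \<subset> F" using F' nin by auto
    have "edge_dominating (delete_verts G {u, v}) (F' - {{u, v}})"
      unfolding edge_dominating_def
    proof (intro conjI ballI)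
      show "F' - {{u, v}} \<subseteq> edges (delete_verts G {u, v})"
        using psub sub by (auto simp: delete_verts_def)
      fix e assume "e \<in> edges (delete_verts G {u, v})"
      then have e: "e \<in> edges G" "e \<inter> {u, v} = {}" by (auto simp: delete_verts_def)
      then consider "e \<in> F'" | f where "f \<in> F'" "e \<inter> f \<noteq> {}"
        using D unfolding edge_dominating_def by blast
      then show "e \<in> F' - {{u, v}} \<or> (\<exists>f\<in>F' - {{u, v}}. e \<inter> f \<noteq> {})"
      proof cases
        case 1
        then show ?thesis using e by auto
      next
        case 2
        then have "f \<noteq> {u, v}" using e by auto
        then show ?thesis using 2 by auto
      qed
    qed
    then show False using psub F by (auto simp: minimal_edge_dominating_def)
  qed
  ultimately show "minimal_edge_dominating G (insert {u, v} F)"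
    by (auto simp: minimal_edge_dominating_def)
qed

text \<open>Puts the edges of the matching back one at a time. The equation is doubled to avoid
  halving \<open>card W\<close>.\<close>

lemma minimal_edge_dominating_matchable:
  assumes "simple_graph G" "matchable G W"
    and "minimal_edge_dominating (delete_verts G W) F"
  obtains F' where "minimal_edge_dominating G F'" "2 * card F' = card W + 2 * card F"
  using assms(2,3)
proof (induction arbitrary: F thesis rule: matchable.induct)
  case empty
  have "delete_verts G {} = G" by (simp add: delete_verts_def)
  then show ?case using empty by auto
next
  case (insert W u v)
  let ?H = "delete_verts G W"
  have eq: "delete_verts G (insert u (insert v W)) = delete_verts ?H {u, v}"
    by (auto simp: delete_verts_def)
  have uv: "adj ?H u v" using insert.hyps by (simp add: adj_delete_verts)
  have H: "simple_graph ?H" by (rule simple_delete_verts[OF assms(1)])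
  have m: "minimal_edge_dominating (delete_verts ?H {u, v}) F" using insert.prems(2) eq by simp
  note ins = minimal_edge_dominating_insert[OF uv m]
  have "F \<subseteq> edges G" using insert.prems(2)
    by (auto simp: minimal_edge_dominating_def edge_dominating_def delete_verts_def)
  then have fin: "finite F" using finite_edges[OF assms(1)] finite_subset by blast
  obtain F' where F': "minimal_edge_dominating G F'"
    "2 * card F' = card W + 2 * card (insert {u, v} F)"
    using insert.IH[OF _ ins(1)] by blast
  have "u \<noteq> v" using insert.hyps adj_irrefl[OF assms(1)] by auto
  then have "card (insert u (insert v W)) = card W + 2"
    using insert.hyps matchable_finite[OF insert.hyps(1)] by simp
  then show ?case using insert.prems(1)[OF F'(1)] F'(2) fin ins(2) by simp
qed

lemma independent_no_edges:
  assumes "simple_graph G" "independent G (verts G - W)"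
  shows "edges (delete_verts G W) = {}"
proof (rule ccontr)
  assume "edges (delete_verts G W) \<noteq> {}"
  then obtain e where "e \<in> edges G" "e \<inter> W = {}" by (auto simp: delete_verts_def)
  moreover obtain u v where "e = {u, v}" "adj G u v" using calculation edge_cases[OF assms(1)] by metis
  ultimately show False using assms adj_verts[OF assms(1)] unfolding independent_def by blast
qed

lemma minimal_edge_dominating_maximal_matching:
  fixes G :: "'a graph"
  assumes "simple_graph G" "matchable G W" "independent G (verts G - W)"
  obtains F where "minimal_edge_dominating G F" "2 * card F = card W"
proof -
  have "minimal_edge_dominating (delete_verts G W) {}"
    using independent_no_edges[OF assms(1,3)]
    by (auto simp: minimal_edge_dominating_def edge_dominating_def)
  then obtain F where "minimal_edge_dominating G F" "2 * card F = card W + 2 * card ({} :: 'a set set)"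
    by (rule minimal_edge_dominating_matchable[OF assms(1,2)])
  then show thesis using that by simp
qed

lemma matchable_verts: "simple_graph G \<Longrightarrow> matchable G W \<Longrightarrow> W \<subseteq> verts G"
  by (rotate_tac, induction rule: matchable.induct) (auto dest: adj_verts)

lemma well_edge_dominated_equimatchable:
  assumes "simple_graph G" "well_edge_dominated G"
  obtains d where "equimatchable G (verts G) d"
proof -
  have fin: "finite (verts G)" using assms(1) by (simp add: simple_graph_def)
  have size: "card U = card U'"
    if that': "U \<subseteq> verts G" "independent G U" "matchable G (verts G - U)"
       "U' \<subseteq> verts G" "independent G U'" "matchable G (verts G - U')" for U U'
  proof -
    have U: "verts G - (verts G - U) = U" "verts G - (verts G - U') = U'" using that by auto
    obtain F where F: "minimal_edge_dominating G F" "2 * card F = card (verts G - U)"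
      using minimal_edge_dominating_maximal_matching[OF assms(1) that'(3)] that'(2) U by auto
    obtain F' where F': "minimal_edge_dominating G F'" "2 * card F' = card (verts G - U')"
      using minimal_edge_dominating_maximal_matching[OF assms(1) that'(6)] that'(5) U by auto
    have "card F = card F'" using F(1) F'(1) assms(2) unfolding well_edge_dominated_def by blast
    then have "card (verts G - U) = card (verts G - U')" using F(2) F'(2) by simp
    moreover have "card U \<le> card (verts G)" "card U' \<le> card (verts G)"
      using that fin by (auto intro: card_mono)
    ultimately show ?thesis using that fin
      by (simp add: card_Diff_subset finite_subset)
  qed
  obtain U where "U \<subseteq> verts G" "independent G U" "matchable G (verts G - U)"
    using maximal_matching_exists[OF fin] adj_irrefl[OF assms(1)] by metis
  then have "equimatchable G (verts G) (card U)" unfolding equimatchable_def using size by blast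
  then show thesis by (rule that)
qed

text \<open>A matching together with a star centred at \<open>v\<close> is a minimal edge dominating set of
  \<open>card W div 2 + card N\<close> edges; comparing it with a maximal matching gives the equation.\<close>

lemma well_edge_dominated_star:
  assumes G: "simple_graph G" "well_edge_dominated G" "equimatchable G (verts G) d"
    and W: "matchable G W"
    and V: "verts G - W = insert v (N \<union> U)" "v \<notin> N \<union> U" "N \<inter> U = {}"
    and N: "\<And>w. w \<in> N \<Longrightarrow> adj G v w" "\<And>w. w \<in> N \<Longrightarrow> \<exists>u\<in>U. adj G w u"
    and U: "independent G U" "\<And>u. u \<in> U \<Longrightarrow> \<not> adj G v u"
    and "N \<noteq> {}"
  shows "card U + 1 = card N + d"
proof -
  let ?H = "delete_verts G W" and ?F = "(\<lambda>w. {v, w}) ` N"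
  have fin: "finite (verts G)" using G(1) by (simp add: simple_graph_def)
  have WV: "W \<subseteq> verts G" using matchable_verts[OF G(1) W] .
  have H: "simple_graph ?H" by (rule simple_delete_verts[OF G(1)])
  have sub: "?F \<subseteq> edges ?H" using N(1) V(1) by (auto simp: delete_verts_def adj_def)
  have "edge_dominating ?H ?F"
    unfolding edge_dominating_def
  proof (intro conjI ballI sub)
    fix e assume e: "e \<in> edges ?H"
    then obtain a b where ab: "e = {a, b}" "adj ?H a b" using edge_cases[OF H] by metis
    then have ab': "adj G a b" "a \<in> insert v (N \<union> U)" "b \<in> insert v (N \<union> U)"
      using adj_verts[OF G(1)] V(1) by (auto simp: adj_delete_verts)
    then have "\<not> (a \<in> U \<and> b \<in> U)" using U(1) by (auto simp: independent_def)
    then have "a \<in> insert v N \<or> b \<in> insert v N" using ab' by auto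
    then have "\<exists>w\<in>N. e \<inter> {v, w} \<noteq> {}" using ab(1) \<open>N \<noteq> {}\<close> by auto
    then show "e \<in> ?F \<or> (\<exists>f\<in>?F. e \<inter> f \<noteq> {})" by auto
  qed
  moreover have "\<not> edge_dominating ?H F'" if "F' \<subset> ?F" for F'
  proof
    assume D: "edge_dominating ?H F'"
    from that have "\<exists>w\<in>N. {v, w} \<notin> F'" by blast
    then obtain w where w: "w \<in> N" "{v, w} \<notin> F'" by blast
    \<comment> \<open>The edge from \<open>w\<close> to this \<open>u\<close> is private to
      \<open>{v, w}\<close>: no other edge of the star touches it.\<close>
    obtain u where u: "u \<in> U" "adj G w u" using N(2)[OF w(1)] by auto
    have "w \<notin> W" "u \<notin> W" using w u V(1) by auto
    then have "{w, u} \<in> edges ?H" using u(2) by (auto simp: delete_verts_def adj_def)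
    moreover have "{w, u} \<notin> ?F" using w(1) u(1) V(2) by (auto simp: doubleton_eq_iff)
    then have "{w, u} \<notin> F'" using that by blast
    ultimately have "\<exists>f\<in>F'. {w, u} \<inter> f \<noteq> {}"
      using D unfolding edge_dominating_def by blast
    then obtain f where f: "f \<in> F'" "{w, u} \<inter> f \<noteq> {}" by blast
    from f(1) that have "f \<in> ?F" by blast
    then obtain w' where w': "w' \<in> N" "f = {v, w'}" by blast
    have "v \<noteq> w" "v \<noteq> u" "w' \<noteq> u" using w(1) w'(1) u(1) V(2,3) by auto
    then have "w' = w" using f(2) w'(2) by simp
    then show False using w'(2) f(1) w(2) by simp
  qed
  ultimately have "minimal_edge_dominating ?H ?F" by (simp add: minimal_edge_dominating_def)
  then obtain F1 where F1: "minimal_edge_dominating G F1" "2 * card F1 = card W + 2 * card ?F"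
    using minimal_edge_dominating_matchable[OF G(1) W] by metis
  have "inj_on (\<lambda>w. {v, w}) N" by (auto simp: inj_on_def doubleton_eq_iff)
  then have cF: "card ?F = card N" by (rule card_image)
  \<comment> \<open>A maximal matching for comparison: it has as many edges as \<open>F1\<close> and
    leaves \<open>d\<close> vertices uncovered.\<close>
  obtain B where B: "B \<subseteq> verts G" "independent G B" "matchable G (verts G - B)"
    using maximal_matching_exists[OF fin] adj_irrefl[OF G(1)] by metis
  then have "verts G - (verts G - B) = B" by auto
  then obtain F2 where F2: "minimal_edge_dominating G F2" "2 * card F2 = card (verts G - B)"
    using minimal_edge_dominating_maximal_matching[OF G(1) B(3)] B(2) by auto
  have "card B = d" using B G(3) by (auto simp: equimatchable_def)
  then have "card (verts G) = card (verts G - B) + d"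
    using B(1) fin by (metis card_Diff_subset card_mono finite_subset le_add_diff_inverse2)
  also have "card (verts G - B) = card W + 2 * card N"
  proof -
    have "card F1 = card F2" using F1(1) F2(1) G(2) unfolding well_edge_dominated_def by blast
    then show ?thesis using F1(2) F2(2) cF by simp
  qed
  finally have 1: "card (verts G) = card W + 2 * card N + d" by simp
  have "card (verts G) = card W + card (verts G - W)"
    using WV fin by (metis card_Diff_subset card_mono finite_subset le_add_diff_inverse)
  moreover have "finite (N \<union> U)" using V(1) fin by (metis finite_Diff finite_insert)
  then have "card (insert v (N \<union> U)) = 1 + card N + card U"
    using V(2,3) card_Un_disjoint[of N U] by simp
  ultimately show ?thesis using 1 V(1) by simp
qed

section \<open>Components\<close>

text \<open>Maximality holds because a connected subgraph through \<open>v\<close> cannot leave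
  \<open>W\<close>, and all edges inside \<open>W\<close> are already taken.\<close>

lemma component_reachable:
  assumes H: "simple_graph H" and v: "v \<in> verts H"
  defines "W \<equiv> {w. (adj H)\<^sup>*\<^sup>* v w}"
  shows "component \<lparr>verts = W, edges = {e \<in> edges H. e \<subseteq> W}\<rparr> H"
proof -
  let ?C = "\<lparr>verts = W, edges = {e \<in> edges H. e \<subseteq> W}\<rparr>"
  have adjC: "adj ?C a b \<longleftrightarrow> adj H a b \<and> a \<in> W \<and> b \<in> W" for a b
    by (auto simp: adj_def)
  have symC: "symp (adj ?C)" by (auto intro!: sympI adj_sym)
  have WV: "W \<subseteq> verts H"
  proof
    fix w assume "w \<in> W"
    then have "(adj H)\<^sup>*\<^sup>* v w" by (simp add: W_def)
    then show "w \<in> verts H" by induction (use v adj_verts[OF H] in auto)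
  qed
  have sub: "subgraph ?C H"
    using H WV by (auto simp: subgraph_def simple_graph_def intro: finite_subset)
  have from_v: "(adj ?C)\<^sup>*\<^sup>* v w" if "w \<in> W" for w
  proof -
    have "(adj H)\<^sup>*\<^sup>* v w" using that by (simp add: W_def)
    then show ?thesis
    proof induction
      case (step a b)
      then have "adj ?C a b" using adjC by (auto simp: W_def)
      then show ?case using step.IH by auto
    qed simp
  qed
  have "connected ?C"
    unfolding connected_def
  proof (intro conjI ballI)
    show "verts ?C \<noteq> {}" by (auto simp: W_def)
    fix a b assume "a \<in> verts ?C" "b \<in> verts ?C"
    then have va: "(adj ?C)\<^sup>*\<^sup>* v a" and vb: "(adj ?C)\<^sup>*\<^sup>* v b" using from_v by auto
    show "(adj ?C)\<^sup>*\<^sup>* a b"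
      using rtranclp_trans[OF sympD[OF symp_rtranclp[OF symC] va] vb] .
  qed
  moreover have "D = ?C" if D: "subgraph D H" "connected D" "subgraph ?C D" for D
  proof -
    have "v \<in> verts D" using D(3) by (auto simp: subgraph_def W_def)
    have DH: "adj D \<le> adj H" using D(1) by (auto simp: subgraph_def adj_def)
    have "verts D \<subseteq> W"
      using D(2) \<open>v \<in> verts D\<close> rtranclp_mono[OF DH] unfolding connected_def W_def by blast
    then have V: "verts D = W" using D(3) by (auto simp: subgraph_def)
    moreover have "edges D = {e \<in> edges H. e \<subseteq> W}"
    proof
      show "edges D \<subseteq> {e \<in> edges H. e \<subseteq> W}"
        using D(1) V by (auto simp: subgraph_def simple_graph_def)
    qed (use D(3) in \<open>auto simp: subgraph_def\<close>)
    ultimately show ?thesis by simp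
  qed
  ultimately show ?thesis using sub unfolding component_def by blast
qed

text \<open>A vertex with a neighbour lies in a nontrivial component, so uniqueness puts
  \<open>a\<close> and \<open>b\<close> into the same one.\<close>

lemma one_nontrivial_component_reach:
  assumes H: "simple_graph H" and one: "\<exists>!C. component C H \<and> nontrivial C"
    and a: "adj H a a'" and b: "adj H b b'"
  shows "(adj H)\<^sup>*\<^sup>* a b"
proof -
  let ?C = "\<lambda>v. \<lparr>verts = {w. (adj H)\<^sup>*\<^sup>* v w}, edges = {e \<in> edges H. e \<subseteq> {w. (adj H)\<^sup>*\<^sup>* v w}}\<rparr>"
  have C: "component (?C v) H \<and> nontrivial (?C v)" if "adj H v v'" for v v'
  proof
    have v: "v \<in> verts H" using adj_verts[OF H that] by auto
    show comp: "component (?C v) H" by (rule component_reachable[OF H v])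
    then have "finite (verts (?C v))" by (auto simp: component_def subgraph_def simple_graph_def)
    moreover have "{v, v'} \<subseteq> verts (?C v)" using that by auto
    moreover have "v \<noteq> v'" using that adj_irrefl[OF H] by auto
    then have "card {v, v'} = 2" by simp
    ultimately show "nontrivial (?C v)" unfolding nontrivial_def by (metis card_mono)
  qed
  have "?C a = ?C b" using one C[OF a] C[OF b] by blast
  then have "{w. (adj H)\<^sup>*\<^sup>* a w} = {w. (adj H)\<^sup>*\<^sup>* b w}" by simp
  then show ?thesis by blast
qed

section \<open>Graphs with a unique triangle\<close>

lemma matchable_insert_eq:
  "matchable G W \<Longrightarrow> adj G u v \<Longrightarrow> u \<notin> W \<Longrightarrow> v \<notin> W \<Longrightarrow> S = insert u (insert v W) \<Longrightarrow> matchable G S"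
  using matchable.insert by metis

text \<open>Uncovered by some maximal matching of the graph induced on \<open>R\<close>. Once
  \<open>uncovered_R\<close> gives all these matchings the same size, this is the set D of the
  Gallai-Edmonds decomposition.\<close>

definition missable :: "'a graph \<Rightarrow> 'a set \<Rightarrow> 'a \<Rightarrow> bool" where
  "missable G R u \<longleftrightarrow> (\<exists>U. U \<subseteq> R \<and> independent G U \<and> matchable G (R - U) \<and> u \<in> U)"

text \<open>Only assumptions symmetric in \<open>x\<close>, \<open>y\<close>, \<open>z\<close> are
  collected, so that lemmas transfer along the permutations below. The component hypothesis singles
  out \<open>z\<close> and enters later.\<close>

locale unique_triangle =
  fixes G :: "'a graph" and x y z :: 'a and R :: "'a set" and d :: nat
  assumes simple: "simple_graph G"
    and equi: "equimatchable G (verts G) d"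
    and R: "R = verts G - {x, y, z}"
    and tri: "adj G x y" "adj G y z" "adj G x z"
    and uniq: "\<And>a b c. adj G a b \<Longrightarrow> adj G b c \<Longrightarrow> adj G a c \<Longrightarrow> {a, b, c} = {x, y, z}"
    and nbr: "\<exists>a\<in>R. adj G x a" "\<exists>a\<in>R. adj G y a" "\<exists>a\<in>R. adj G z a"
begin

abbreviation adjacent (infix "\<sim>" 50) where "a \<sim> b \<equiv> adj G a b"
abbreviation "indep \<equiv> independent G"
abbreviation "pm \<equiv> matchable G"
abbreviation "V \<equiv> verts G"
abbreviation "miss \<equiv> missable G R"

lemma swap_xy: "unique_triangle G y x z R d"
proof
  have "{y, x, z} = {x, y, z}" by auto
  then show "R = verts G - {y, x, z}"
    "\<And>a b c. adj G a b \<Longrightarrow> adj G b c \<Longrightarrow> adj G a c \<Longrightarrow> {a, b, c} = {y, x, z}"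
    using R uniq by simp_all
qed (fact simple equi tri[THEN adj_sym] tri nbr)+

lemma swap_yz: "unique_triangle G x z y R d"
proof
  have "{x, z, y} = {x, y, z}" by auto
  then show "R = verts G - {x, z, y}"
    "\<And>a b c. adj G a b \<Longrightarrow> adj G b c \<Longrightarrow> adj G a c \<Longrightarrow> {a, b, c} = {x, z, y}"
    using R uniq by simp_all
qed (fact simple equi tri[THEN adj_sym] tri nbr)+

lemma swap_xz: "unique_triangle G z y x R d"
  using unique_triangle.swap_xy[OF unique_triangle.swap_yz[OF swap_xy]] .

lemma irrefl [simp]: "\<not> a \<sim> a"
  using adj_irrefl[OF simple] .

lemma sym: "a \<sim> b \<longleftrightarrow> b \<sim> a"
  using adj_sym by metis

lemma distinct: "x \<noteq> y" "y \<noteq> z" "x \<noteq> z"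
  using tri irrefl by metis+

lemma triangle_in_V: "x \<in> V" "y \<in> V" "z \<in> V"
  using tri adj_verts[OF simple] by blast+

lemma not_in_R: "x \<notin> R" "y \<notin> R" "z \<notin> R"
  by (auto simp: R)

lemma V_eq: "V = insert x (insert y (insert z R))"
  using triangle_in_V by (auto simp: R)

lemma finite_R: "finite R"
  using simple by (simp add: simple_graph_def R)

lemma no_triangle:
  assumes "a \<sim> b" "b \<sim> c" "a \<sim> c" shows "a \<notin> R"
  using uniq[OF assms] not_in_R by auto

lemma no_common_nbr:
  assumes "a \<in> R" shows "\<not> (x \<sim> a \<and> y \<sim> a)" "\<not> (x \<sim> a \<and> z \<sim> a)" "\<not> (y \<sim> a \<and> z \<sim> a)"
  using no_triangle[of a x y] no_triangle[of a x z] no_triangle[of a y z] tri sym assms by metis+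

lemma indep_insert: "indep (insert a U) \<longleftrightarrow> indep U \<and> (\<forall>u\<in>U. \<not> a \<sim> u)"
  using sym by (auto simp: independent_def)

lemma indep_mono: "indep U \<Longrightarrow> U' \<subseteq> U \<Longrightarrow> indep U'"
  by (auto simp: independent_def)

section \<open>Counting the vertices left by maximal matchings of \<open>R\<close>\<close>

lemma uncovered_card: "B \<subseteq> V \<Longrightarrow> indep B \<Longrightarrow> pm (V - B) \<Longrightarrow> card B = d"
  using equi by (auto simp: equimatchable_def)

text \<open>Adding the edge \<open>xy\<close> to the matching of \<open>R\<close> leaves
  \<open>U\<close> and \<open>z\<close>. If \<open>z\<close> has no neighbour in \<open>U\<close>,
  this set is independent; otherwise \<open>z\<close> is matched into \<open>U\<close>, which leaves
  one vertex of \<open>U\<close> fewer.\<close>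

lemma uncovered_R_z:
  assumes U: "U \<subseteq> R" "indep U" "pm (R - U)"
  shows "\<forall>u\<in>U. \<not> z \<sim> u \<Longrightarrow> card U + 1 = d" "z' \<in> U \<Longrightarrow> z \<sim> z' \<Longrightarrow> card U = d + 1"
proof -
  have fin: "finite U" using U(1) finite_R finite_subset by blast
  have xy: "pm (insert x (insert y (R - U)))"
    using U(3) tri not_in_R by (intro matchable.insert) auto
  show "card U + 1 = d" if "\<forall>u\<in>U. \<not> z \<sim> u"
  proof -
    have "V - insert z U = insert x (insert y (R - U))" using U(1) not_in_R V_eq distinct by auto
    then have "card (insert z U) = d" using uncovered_card[of "insert z U"] xy U that V_eq
      by (auto simp: indep_insert)
    then show ?thesis using U(1) not_in_R fin by (metis card_insert_disjoint subsetD Suc_eq_plus1)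
  qed
  show "card U = d + 1" if "z' \<in> U" "z \<sim> z'"
  proof -
    have "pm (V - (U - {z'}))"
      by (rule matchable_insert_eq[OF xy that(2)]) (use U(1) not_in_R V_eq distinct that(1) in auto)
    then have "card (U - {z'}) = d" using uncovered_card[of "U - {z'}"] U V_eq
      by (auto intro: indep_mono)
    then show ?thesis using that(1) fin by (metis card_Suc_Diff1 Suc_eq_plus1)
  qed
qed

text \<open>Otherwise \<open>U\<close> would meet all three neighbourhoods, and matching each of \<open>x\<close>, \<open>y\<close>, \<open>z\<close>
  into \<open>U\<close> would cover too many vertices.\<close>

lemma uncovered_R:
  assumes U: "U \<subseteq> R" "indep U" "pm (R - U)"
  shows "card U + 1 = d" "\<And>u. u \<in> U \<Longrightarrow> \<not> x \<sim> u \<and> \<not> y \<sim> u \<and> \<not> z \<sim> u"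
proof -
  have fin: "finite U" using U(1) finite_R finite_subset by blast
  \<comment> \<open>Each corner of the triangle decides between the sizes d - 1 and d + 1 of
    \<open>U\<close>, so the three corners agree.\<close>
  have 1: "(\<exists>u\<in>U. x \<sim> u) \<longleftrightarrow> card U = d + 1" "(\<exists>u\<in>U. y \<sim> u) \<longleftrightarrow> card U = d + 1"
    "(\<exists>u\<in>U. z \<sim> u) \<longleftrightarrow> card U = d + 1"
    using unique_triangle.uncovered_R_z[OF swap_xz U] unique_triangle.uncovered_R_z[OF swap_yz U]
      uncovered_R_z[OF U] by fastforce+
  have "card U \<noteq> d + 1"
  proof
    assume card: "card U = d + 1"
    then obtain x' y' z' where n: "x' \<in> U" "x \<sim> x'" "y' \<in> U" "y \<sim> y'" "z' \<in> U" "z \<sim> z'"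
      using 1 by auto
    then have ne: "x' \<noteq> y'" "y' \<noteq> z'" "x' \<noteq> z'" using no_common_nbr U(1) by blast+
    have "pm (insert x (insert x' (insert y (insert y' (insert z (insert z' (R - U)))))))"
      using n ne U not_in_R distinct by (intro matchable.insert) auto
    moreover have "insert x (insert x' (insert y (insert y' (insert z (insert z' (R - U))))))
      = V - (U - {x', y', z'})"
      using n U(1) not_in_R V_eq by auto
    ultimately have "card (U - {x', y', z'}) = d"
      using uncovered_card[of "U - {x', y', z'}"] U V_eq by (auto intro: indep_mono)
    moreover have "card {x', y', z'} = 3" using ne by simp
    then have "card (U - {x', y', z'}) = card U - 3" "3 \<le> card U"
      using n fin card_mono[of U "{x', y', z'}"] by (auto simp: card_Diff_subset)
    ultimately show False using card by simp
  qed
  then show "\<And>u. u \<in> U \<Longrightarrow> \<not> x \<sim> u \<and> \<not> y \<sim> u \<and> \<not> z \<sim> u" using 1 by blast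
  then show "card U + 1 = d" using uncovered_R_z(1)[OF U] by blast
qed

section \<open>Missable vertices and alternating exchanges\<close>

lemma nbr_not_miss: "x \<sim> u \<or> y \<sim> u \<or> z \<sim> u \<Longrightarrow> \<not> miss u"
  using uncovered_R unfolding missable_def by blast

lemma maximal_R:
  assumes "T \<subseteq> R"
  obtains U where "U \<subseteq> T" "indep U" "pm (T - U)"
  using maximal_matching_exists[of T G] irrefl assms finite_R finite_subset by metis

lemma extend_R:
  assumes "L \<subseteq> R" "pm (R - L)"
  obtains U where "U \<subseteq> L" "indep U" "pm (R - U)" "card U + 1 = d"
proof -
  obtain U where U: "U \<subseteq> L" "indep U" "pm (L - U)" using maximal_R[OF assms(1)] .
  have "R - U = (R - L) \<union> (L - U)" using assms(1) U(1) by auto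
  then have "pm (R - U)" using matchable_Un[OF assms(2) U(3)] by auto
  then show thesis using that[of U] U uncovered_R(1)[of U] assms(1) by auto
qed

text \<open>A maximal matching that covers \<open>R - L\<close> leaves d - 1 vertices, all of them
  in \<open>L\<close>, hence the whole of \<open>L\<close>. Counting thus replaces a check of
  independence.\<close>

lemma missI:
  assumes "L \<subseteq> R" "pm (R - L)" "card L + 1 = d"
  shows "indep L" "u \<in> L \<Longrightarrow> miss u"
proof -
  obtain U where U: "U \<subseteq> L" "indep U" "pm (R - U)" "card U + 1 = d" using extend_R assms by metis
  have "U = L" using card_subset_eq[of L U] U assms finite_R finite_subset by (metis add_right_imp_eq)
  then show "indep L" "u \<in> L \<Longrightarrow> miss u" using U assms(1) by (auto simp: missable_def)
qed

lemma indep_miss: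
  assumes "U \<subseteq> R" "indep U" "pm (R - U)" "u \<in> U"
  shows "miss u"
  using assms by (auto simp: missable_def)

lemma card_swap: "finite U \<Longrightarrow> u \<in> U \<Longrightarrow> a \<notin> U \<Longrightarrow> card (insert a (U - {u})) = card U"
  by (metis Diff_iff card_Suc_Diff1 card_insert_disjoint finite_Diff)

text \<open>Exchange step: \<open>W\<close> is kept, the edge \<open>bu\<close> covers
  \<open>u\<close>, and \<open>a\<close> is uncovered in its place. The number of uncovered vertices
  is unchanged, so \<open>missI\<close> applies.\<close>

lemma miss_swap:
  assumes U: "U \<subseteq> R" "card U + 1 = d" and W: "pm W" "u \<in> U" "a \<in> R" "a \<notin> U"
    "b \<sim> u" "b \<notin> W" "u \<notin> W" "insert b (insert u W) = R - insert a (U - {u})"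
  shows "miss a"
proof (rule missI(2)[of "insert a (U - {u})"])
  show "pm (R - insert a (U - {u}))" using matchable.insert[OF W(1,5,6,7)] W(8) by simp
  show "card (insert a (U - {u})) + 1 = d"
    using card_swap[OF _ W(2,4)] U finite_R finite_subset by metis
qed (use assms in auto)

text \<open>If \<open>a\<close> were always covered, take a maximal matching that misses
  \<open>u\<close> and has edges \<open>bb'\<close> and \<open>aa'\<close>. Trading these for
  \<open>ab\<close> uncovers two vertices too many, so there is an edge between \<open>a'\<close>
  and \<open>b'\<close> or from one of them to \<open>U\<close>; each such edge yields an exchange
  that misses \<open>a\<close> or \<open>b\<close>.\<close>

lemma miss_nbr:
  assumes "a \<in> R" "b \<in> R" "\<not> miss b" "miss u" "b \<sim> u" "a \<sim> b"
  shows "miss a"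
proof (rule ccontr)
  assume na: "\<not> miss a"
  obtain U where U: "U \<subseteq> R" "indep U" "pm (R - U)" "u \<in> U"
    using assms(4) by (auto simp: missable_def)
  have cU: "card U + 1 = d" using uncovered_R(1)[OF U(1-3)] .
  have fin: "finite U" using U(1) finite_R finite_subset by blast
  have aU: "a \<notin> U" "b \<notin> U" using na assms(3) U by (auto simp: missable_def)
  obtain b' where b': "b' \<in> R - U" "b \<sim> b'" "pm (R - U - {b, b'})"
    using matchable_partner[OF U(3), of b] assms(2) aU by auto
  have ab: "a \<noteq> b" using assms(6) by auto
  have bb: "b \<noteq> b'" using b'(2) by auto
  show False
  proof (cases "b' = a")
    case True
    have "miss a"
      by (rule miss_swap[OF U(1) cU b'(3) U(4) assms(1) aU(1) assms(5)])
        (use True U(1,4) assms(2) aU ab in auto)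
    then show False using na by simp
  next
    case False
    obtain a' where a': "a' \<in> R - U - {b, b'}" "a \<sim> a'" "pm (R - U - {b, b'} - {a, a'})"
      using matchable_partner[OF b'(3), of a] assms(1) aU False ab by auto
    have aa: "a \<noteq> a'" using a'(2) by auto
    let ?W = "R - U - {b, b'} - {a, a'}" and ?L = "insert a' (insert b' U)"
    have pW: "pm (insert a (insert b ?W))" "pm (insert a (insert a' ?W))" "pm (insert b (insert b' ?W))"
      using a' b' assms(6) by (auto intro: matchable.insert)
    have "R - ?L = insert a (insert b ?W)" using a'(1) b'(1) aU assms(1,2) aa ab bb False by auto
    then have "pm (R - ?L)" using pW(1) by simp
    moreover have "?L \<subseteq> R" using a'(1) b'(1) U(1) by auto
    moreover have "card ?L = card U + 2" using a'(1) b'(1) fin by auto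
    ultimately have "\<not> indep ?L" using uncovered_R(1)[of ?L] cU by auto
    then consider "a' \<sim> b'" | w where "w \<in> U" "a' \<sim> w" | w where "w \<in> U" "b' \<sim> w"
      using U(2) by (auto simp: indep_insert)
    then show False
    proof cases
      case 1
      have "pm (insert a' (insert b' ?W))" using 1 a' b' by (auto intro: matchable.insert)
      then have "miss a"
        by (rule miss_swap[OF U(1) cU _ U(4) assms(1) aU(1) assms(5)])
          (use U(1,4) assms(1,2) aU ab aa bb a'(1) b'(1) False in auto)
      then show False using na by simp
    next
      case 2
      have "miss a"
        by (rule miss_swap[OF U(1) cU pW(3) 2(1) assms(1) aU(1) 2(2)])
          (use U(1) 2(1) assms(1,2) aU ab aa bb a'(1) b'(1) False in auto)
      then show False using na by simp
    next
      case 3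
      have "miss b"
        by (rule miss_swap[OF U(1) cU pW(2) 3(1) assms(2) aU(2) 3(2)])
          (use U(1) 3(1) assms(1,2) aU ab aa bb a'(1) b'(1) False in auto)
      then show False using assms(3) by simp
    qed
  qed
qed

text \<open>By \<open>miss_nbr\<close> all neighbours of \<open>x'\<close> and \<open>z'\<close> in
  \<open>R\<close> are missable. A maximal matching of \<open>R\<close> without \<open>x'\<close>
  and \<open>z'\<close> leaves d + 1 vertices, among them partners for both. With the edges
  \<open>xx'\<close> and \<open>zz'\<close> added, these and \<open>y\<close> remain: two too many,
  unless \<open>y\<close> has a neighbour among them, but all of them are missable.\<close>

lemma not_both_near_miss:
  assumes x': "x' \<in> R" "x \<sim> x'" "x' \<sim> u1" "miss u1"
    and z': "z' \<in> R" "z \<sim> z'" "z' \<sim> u2" "miss u2"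
  shows False
proof -
  have nm: "\<not> miss x'" "\<not> miss z'" using x' z' nbr_not_miss by auto
  have mx: "miss q" if "q \<in> R" "x' \<sim> q" for q
    using miss_nbr[OF that(1) x'(1) nm(1) x'(4,3)] that(2) sym by metis
  have mz: "miss q" if "q \<in> R" "z' \<sim> q" for q
    using miss_nbr[OF that(1) z'(1) nm(2) z'(4,3)] that(2) sym by metis
  have nadj: "\<not> x' \<sim> z'" "\<not> z' \<sim> x'" using mx[OF z'(1)] nm sym by metis+
  have ne: "x' \<noteq> z'" using no_common_nbr x' z' by auto
  obtain U where U: "U \<subseteq> R - {x', z'}" "indep U" "pm (R - {x', z'} - U)"
    using maximal_R[of "R - {x', z'}"] by auto
  have fin: "finite U" using U(1) finite_R finite_subset by blast
  have UR: "U \<subseteq> R" "x' \<notin> U" "z' \<notin> U" using U(1) by auto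
  have pz: "pm (R - insert x' (U - {q}))" if "q \<in> U" "z' \<sim> q" for q
    by (rule matchable_insert_eq[OF U(3) that(2)]) (use that(1) UR z'(1) ne in auto)
  have px: "pm (R - insert z' (U - {q}))" if "q \<in> U" "x' \<sim> q" for q
    by (rule matchable_insert_eq[OF U(3) that(2)]) (use that(1) UR x'(1) ne in auto)
  \<comment> \<open>Otherwise some maximal matching of \<open>R\<close> would miss
    \<open>x'\<close>, with \<open>z'\<close> matched into \<open>U\<close> or missed as
    well.\<close>
  have "\<exists>q\<in>U. x' \<sim> q"
  proof (rule ccontr)
    assume c: "\<not> (\<exists>q\<in>U. x' \<sim> q)"
    show False
    proof (cases "\<exists>q\<in>U. z' \<sim> q")
      case True
      then obtain q where "q \<in> U" "z' \<sim> q" by auto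
      moreover have "indep (insert x' (U - {q}))"
        using c U(2) by (auto simp: indep_insert intro: indep_mono)
      ultimately show False using indep_miss[of "insert x' (U - {q})" x'] pz[of q] UR x'(1) nm(1) by auto
    next
      case False
      have "indep (insert x' (insert z' U))" using c False U(2) nadj by (auto simp: indep_insert)
      moreover have "R - insert x' (insert z' U) = R - {x', z'} - U" by auto
      ultimately show False
        using indep_miss[of "insert x' (insert z' U)" x'] U(3) UR x'(1) z'(1) nm(1) by auto
    qed
  qed
  then obtain q1 where q1: "q1 \<in> U" "x' \<sim> q1" by auto
  have "\<exists>q\<in>U - {q1}. z' \<sim> q"
  proof (rule ccontr)
    assume "\<not> (\<exists>q\<in>U - {q1}. z' \<sim> q)"
    then have "indep (insert z' (U - {q1}))"
      using U(2) by (auto simp: indep_insert intro: indep_mono)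
    then show False using indep_miss[of "insert z' (U - {q1})" z'] px[OF q1] UR z'(1) nm(2) by auto
  qed
  then obtain q2 where q2: "q2 \<in> U - {q1}" "z' \<sim> q2" by auto
  let ?L = "U - {q1, q2}"
  have L: "?L \<subseteq> R" "indep ?L" using UR U(2) by (auto intro: indep_mono)
  have pL: "pm (R - ?L)"
    by (rule matchable_insert_eq[OF px[OF q1] q2(2)]) (use q1 q2 UR z'(1) in auto)
  have "card ?L + 1 = d" using uncovered_R(1)[OF L pL] .
  moreover have "card U = card ?L + 2"
  proof -
    have "card {q1, q2} = 2" using q2 by auto
    then show ?thesis using q1 q2 fin card_mono[of U "{q1, q2}"] by (simp add: card_Diff_subset)
  qed
  ultimately have cU: "card (insert y U) \<noteq> d" using fin UR(1) not_in_R by (auto simp: card_insert_if)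
  have xx: "pm (insert x (insert x' (R - {x', z'} - U)))"
    using U(3) x'(2) not_in_R by (intro matchable.insert) auto
  have "pm (V - insert y U)"
    by (rule matchable_insert_eq[OF xx z'(2)])
      (use UR x'(1) z'(1) not_in_R V_eq distinct ne in auto)
  then have "\<not> indep (insert y U)" using cU uncovered_card[of "insert y U"] UR(1) V_eq by auto
  then obtain y' where y': "y' \<in> U" "y \<sim> y'" using U(2) by (auto simp: indep_insert)
  then have "\<not> miss y'" using nbr_not_miss by auto
  moreover have "miss q1" "miss q2" using mx q1 mz q2 UR by auto
  ultimately have "y' \<in> ?L" using y' by auto
  then show False using indep_miss[OF L pL] \<open>\<not> miss y'\<close> by auto
qed

text \<open>A maximal matching of \<open>R\<close> through \<open>x'q\<close> also has an edge
  \<open>z'p\<close>. Replacing both by \<open>xx'\<close> and \<open>zz'\<close> leaves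
  \<open>y\<close>, \<open>q\<close>, \<open>p\<close> and the d - 1 missed vertices: too many, yet
  independent unless \<open>y\<close> is adjacent to \<open>q\<close>.\<close>

lemma opposite_is_nbr:
  assumes z': "z' \<in> R" "z \<sim> z'" "z' \<sim> u" "miss u"
    and x': "x' \<in> R" "x \<sim> x'" "\<And>m. x' \<sim> m \<Longrightarrow> \<not> miss m"
    and q: "q \<in> R" "x' \<sim> q"
  shows "y \<sim> q"
proof (rule ccontr)
  assume nyq: "\<not> y \<sim> q"
  have nm: "\<not> miss x'" "\<not> miss z'" using x' z' nbr_not_miss by auto
  have mz: "miss p" if "p \<in> R" "z' \<sim> p" for p
    using miss_nbr[OF that(1) z'(1) nm(2) z'(4,3)] that(2) sym by metis
  have nq: "\<not> miss q" using x'(3)[OF q(2)] .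
  \<comment> \<open>A missable neighbour of \<open>q\<close> would make \<open>x'\<close> missable
    by \<open>miss_nbr\<close>.\<close>
  have qm: "\<not> miss m" if "q \<sim> m" for m
    using miss_nbr[OF x'(1) q(1) nq _ that q(2)] nm(1) by auto
  have ne: "x' \<noteq> z'" "q \<noteq> x'" "q \<noteq> z'" using no_common_nbr x'(1,2) z' q qm by auto
  obtain U where U: "U \<subseteq> R - {x', q}" "indep U" "pm (R - {x', q} - U)"
    using maximal_R[of "R - {x', q}"] by auto
  have fin: "finite U" using U(1) finite_R finite_subset by blast
  have UR: "U \<subseteq> R" "x' \<notin> U" "q \<notin> U" using U(1) by auto
  have pU: "pm (R - U)"
    by (rule matchable_insert_eq[OF U(3) q(2)]) (use UR x'(1) q(1) ne in auto)
  have cU: "card U + 1 = d" using uncovered_R(1)[OF UR(1) U(2) pU] .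
  have mU: "miss m" if "m \<in> U" for m using indep_miss[OF UR(1) U(2) pU that] .
  have zU: "z' \<notin> U" using mU nm by auto
  obtain p where p: "p \<in> R - {x', q} - U" "z' \<sim> p" "pm (R - {x', q} - U - {z', p})"
    using matchable_partner[OF U(3), of z'] z'(1) zU ne by auto
  have zp: "z' \<noteq> p" using p(2) by auto
  have mp: "miss p" using mz p by auto
  have p': "pm (insert x' (insert q (R - {x', q} - U - {z', p})))"
    using p(3) q(2) by (intro matchable.insert) auto
  \<comment> \<open>An edge \<open>pw\<close> could replace \<open>z'p\<close>, and then
    \<open>z'\<close> would be missed.\<close>
  have npU: "\<not> p \<sim> w" if w: "w \<in> U" for w
  proof
    assume pw: "p \<sim> w"
    have "miss z'"
      by (rule miss_swap[OF UR(1) cU p' w z'(1) zU pw])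
        (use UR w z'(1) x'(1) q(1) p(1) ne zU zp in auto)
    then show False using nm by simp
  qed
  let ?B = "insert y (insert q (insert p U))"
  have "indep ?B"
    using U(2) npU nyq mp mU qm nbr_not_miss by (auto simp: indep_insert)
  moreover have xx: "pm (insert x (insert x' (R - {x', q} - U - {z', p})))"
    using p(3) x'(2) not_in_R by (intro matchable.insert) auto
  have "pm (V - ?B)"
    by (rule matchable_insert_eq[OF xx z'(2)])
      (use UR x'(1) z'(1) q(1) p(1) not_in_R V_eq distinct ne zU zp in auto)
  moreover have "?B \<subseteq> V" using UR q(1) p(1) V_eq by auto
  ultimately have "card ?B = d" using uncovered_card by blast
  moreover have "y \<notin> insert q (insert p U)" "q \<notin> insert p U" "p \<notin> U"
    using UR q(1) p(1) not_in_R by auto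
  then have "card ?B = card U + 3" using fin by simp
  ultimately show False using cU by simp
qed

section \<open>Walks inside \<open>R\<close> and the component hypothesis\<close>

definition reach :: "'a \<Rightarrow> 'a \<Rightarrow> bool" where
  "reach = (\<lambda>a b. a \<in> R \<and> b \<in> R \<and> a \<sim> b)\<^sup>*\<^sup>*"

lemma reach_induct [consumes 2, case_names base step]:
  assumes "reach a b" "a \<in> R" "P a"
    and "\<And>r s. r \<in> R \<Longrightarrow> s \<in> R \<Longrightarrow> r \<sim> s \<Longrightarrow> P r \<Longrightarrow> P s"
  shows "P b"
  using assms(1) unfolding reach_def by (induction rule: rtranclp_induct) (use assms in auto)

text \<open>Both \<open>r\<close> and \<open>z\<close> have neighbours outside
  \<open>{x, y}\<close>, so both lie in the one nontrivial component. A walk from \<open>r\<close>,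
  cut off where it first arrives at \<open>z\<close>, stays in \<open>R\<close> and ends at a
  neighbour of \<open>z\<close>.\<close>

lemma reach_z_nbr:
  assumes "connected G"
    and one: "\<exists>!C. component C (delete_verts G {x, y}) \<and> nontrivial C"
    and r: "r \<in> R"
  shows "\<exists>z'\<in>R. z \<sim> z' \<and> reach r z'"
proof -
  let ?H = "delete_verts G {x, y}"
  have H: "simple_graph ?H" by (rule simple_delete_verts[OF simple])
  have adjH: "adj ?H a b \<longleftrightarrow> a \<sim> b \<and> a \<notin> {x, y} \<and> b \<notin> {x, y}" for a b
    by (rule adj_delete_verts)
  have "\<exists>s. adj ?H r s"
  proof -
    have "(adj G)\<^sup>*\<^sup>* r x" using assms(1) r triangle_in_V V_eq by (auto simp: connected_def)
    then obtain s where s: "r \<sim> s" using r not_in_R by (metis converse_rtranclpE)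
    show ?thesis
    proof (cases "s \<in> {x, y}")
      case True
      \<comment> \<open>A neighbour of \<open>x\<close> or \<open>y\<close> is never missed, so a
        partner in a matching of \<open>R\<close> serves as the neighbour sought.\<close>
      then have "\<not> miss r" using nbr_not_miss s sym by blast
      obtain U where U: "U \<subseteq> R" "indep U" "pm (R - U)" using maximal_R[of R] by auto
      then have "r \<in> R - U" using indep_miss \<open>\<not> miss r\<close> r by blast
      then obtain s' where "s' \<in> R - U" "r \<sim> s'" using matchable_partner[OF U(3)] by metis
      then show ?thesis using adjH r not_in_R by auto
    next
      case False
      then show ?thesis using s adjH r not_in_R by auto
    qed
  qed
  moreover obtain w where "w \<in> R" "z \<sim> w" using nbr by auto
  then have "adj ?H z w" using adjH distinct not_in_R by auto
  ultimately have "(adj ?H)\<^sup>*\<^sup>* r z" using one_nontrivial_component_reach[OF H one] by blast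
  then show ?thesis using r
  proof (induction rule: converse_rtranclp_induct)
    case base
    then show ?case using not_in_R by simp
  next
    case (step a b)
    then have ab: "a \<sim> b" "b \<notin> {x, y}" using adjH by auto
    show ?case
    proof (cases "b = z")
      case True
      then show ?thesis using ab step.prems sym unfolding reach_def by blast
    next
      case False
      then have "b \<in> R" using ab adj_verts[OF simple ab(1)] V_eq by auto
      then obtain z' where z': "z' \<in> R" "z \<sim> z'" "reach b z'" using step.IH by auto
      have "reach a z'"
        using z'(3) ab(1) step.prems \<open>b \<in> R\<close> unfolding reach_def
        by (intro converse_rtranclp_into_rtranclp[of _ a b]) simp_all
      then show ?thesis using z' by blast
    qed
  qed
qed

text \<open>On a walk from \<open>u\<close> to a neighbour of \<open>z\<close> every vertex is
  missable or next to a missable one, so some neighbour of \<open>z\<close> is next to one. Then no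
  neighbour of \<open>x\<close> or \<open>y\<close> is, and \<open>opposite_is_nbr\<close> confines
  walks from \<open>x'\<close> to neighbours of \<open>x\<close> and \<open>y\<close>, away from
  those of \<open>z\<close>.\<close>

lemma nothing_miss:
  assumes reach_z: "\<And>r. r \<in> R \<Longrightarrow> \<exists>z'\<in>R. z \<sim> z' \<and> reach r z'"
  shows "\<not> miss u"
proof
  assume u: "miss u"
  have missR: "m \<in> R" if "miss m" for m using that by (auto simp: missable_def)
  obtain z' where z': "z' \<in> R" "z \<sim> z'" "reach u z'" using reach_z missR u by blast
  from z'(3) missR[OF u] have "miss z' \<or> (\<exists>m. miss m \<and> z' \<sim> m)"
  proof (induction rule: reach_induct)
    case (step r s)
    then show ?case
      using miss_nbr[of s r] sym by metis
  qed (use u in simp)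
  then obtain m where m: "miss m" "z' \<sim> m" using nbr_not_miss z'(2) by auto
  have nx: "\<not> miss m'" if "x' \<in> R" "x \<sim> x'" "x' \<sim> m'" for x' m'
    using not_both_near_miss[OF that] z'(1,2) m by blast
  have ny: "\<not> miss m'" if "y' \<in> R" "y \<sim> y'" "y' \<sim> m'" for y' m'
    using unique_triangle.not_both_near_miss[OF swap_xy that] z'(1,2) m by blast
  obtain x' where x': "x' \<in> R" "x \<sim> x'" using nbr by auto
  obtain z1 where z1: "z1 \<in> R" "z \<sim> z1" "reach x' z1" using reach_z x' by blast
  from z1(3) x'(1) have "x \<sim> z1 \<or> y \<sim> z1"
  proof (induction rule: reach_induct)
    case (step r s)
    have "y \<sim> s" if "x \<sim> r"
      using opposite_is_nbr[OF z'(1,2) m(2,1) step(1) that _ step(2,3)] nx[OF step(1) that] by blast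
    moreover have "x \<sim> s" if "y \<sim> r"
      using unique_triangle.opposite_is_nbr[OF swap_xy z'(1,2) m(2,1) step(1) that _ step(2,3)]
        ny[OF step(1) that] by blast
    ultimately show ?case using step(4) by blast
  qed (use x' in simp)
  then show False using no_common_nbr z1 by blast
qed

end

section \<open>Every matching of \<open>R\<close> extends to a perfect one\<close>

locale perfect_rest = unique_triangle +
  assumes no_miss: "\<And>u. \<not> missable G R u"
    and wed: "well_edge_dominated G"
begin

lemma swap_xy': "perfect_rest G y x z R d"
  by (intro perfect_rest.intro perfect_rest_axioms.intro swap_xy no_miss wed)

lemma swap_yz': "perfect_rest G x z y R d"
  by (intro perfect_rest.intro perfect_rest_axioms.intro swap_yz no_miss wed)

lemma swap_xz': "perfect_rest G z y x R d"
  by (intro perfect_rest.intro perfect_rest_axioms.intro swap_xz no_miss wed)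

text \<open>A maximal matching extending the one on \<open>W\<close> misses nothing. The graph on
  \<open>R\<close> is thus what is known as randomly matchable.\<close>

lemma rest_matchable:
  assumes "W \<subseteq> R" "pm W"
  shows "pm (R - W)"
proof -
  obtain U where U: "U \<subseteq> R - W" "indep U" "pm (R - W - U)" using maximal_R[of "R - W"] by auto
  have "W \<union> (R - W - U) = R - U" using assms(1) U(1) by auto
  then have "pm (R - U)" using matchable_Un[OF assms(2) U(3)] by auto
  then have "U = {}" using indep_miss[of U] U(1,2) no_miss by blast
  then show ?thesis using U(3) by simp
qed

lemma R_matchable: "pm R"
  using rest_matchable[OF _ matchable.empty] by simp

lemma d_eq: "d = 1"
  using uncovered_R(1)[of "{}"] R_matchable by (simp add: independent_def)

text \<open>Extend \<open>r1r2\<close>, \<open>r3r4\<close> to a perfect matching of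
  \<open>R\<close> and trade the two edges for \<open>r2r3\<close>: were \<open>r1\<close> and
  \<open>r4\<close> not adjacent, a maximal matching would miss them.\<close>

lemma path4_closes:
  assumes r: "r1 \<in> R" "r2 \<in> R" "r3 \<in> R" "r4 \<in> R"
    and e: "r1 \<sim> r2" "r2 \<sim> r3" "r3 \<sim> r4" and ne: "r1 \<noteq> r3" "r2 \<noteq> r4"
  shows "r1 \<sim> r4"
proof (rule ccontr)
  assume n: "\<not> r1 \<sim> r4"
  have d: "r1 \<noteq> r4" using no_triangle[OF e(1,2)] e(3) r(1) sym by metis
  have d': "r1 \<noteq> r2" "r2 \<noteq> r3" "r3 \<noteq> r4" using e by auto
  have "pm {r1, r2, r3, r4}"
    using matchable_two_edges[OF e(1,3)] d d' ne by auto
  then have "pm (R - {r1, r2, r3, r4})" using rest_matchable r by simp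
  then have "pm (R - {r1, r4})"
    by (rule matchable_insert_eq[OF _ e(2)]) (use r d d' ne in auto)
  moreover have "indep {r1, r4}" using n sym by (auto simp: independent_def)
  ultimately show False using indep_miss[of "{r1, r4}" r1] r no_miss by auto
qed

text \<open>The edges \<open>xx'\<close>, \<open>zz'\<close> and a perfect matching of the rest of
  \<open>R\<close> leave \<open>y\<close>, \<open>q1\<close>, \<open>q2\<close>, which cannot be
  independent because \<open>d = 1\<close>.\<close>

lemma two_edges_cover_y:
  assumes x': "x' \<in> R" "x \<sim> x'" and z': "z' \<in> R" "z \<sim> z'"
    and q1: "q1 \<in> R" "x' \<sim> q1" and q2: "q2 \<in> R" "z' \<sim> q2"
    and ne: "q1 \<noteq> q2" "q1 \<noteq> z'" "q2 \<noteq> x'" and nadj: "\<not> q1 \<sim> q2"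
  shows "y \<sim> q1 \<or> y \<sim> q2"
proof (rule ccontr)
  assume n: "\<not> (y \<sim> q1 \<or> y \<sim> q2)"
  have ne': "x' \<noteq> z'" "x' \<noteq> q1" "z' \<noteq> q2" using no_common_nbr x' z' q1 q2 by auto
  have "pm {x', q1, z', q2}"
    using matchable_two_edges[OF q1(2) q2(2)] ne ne' by auto
  then have "pm (R - {x', q1, z', q2})" using rest_matchable x' z' q1 q2 by simp
  then have xx: "pm (insert x (insert x' (R - {x', q1, z', q2})))"
    using x'(2) not_in_R by (intro matchable.insert) auto
  have "pm (V - {y, q1, q2})"
    by (rule matchable_insert_eq[OF xx z'(2)])
      (use x'(1) z'(1) q1(1) q2(1) not_in_R V_eq distinct ne ne' in auto)
  moreover have "indep {y, q1, q2}" using n nadj sym by (auto simp: independent_def)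
  ultimately have "card {y, q1, q2} = d" using uncovered_card[of "{y, q1, q2}"] V_eq q1 q2 by auto
  moreover have "y \<noteq> q1" "y \<noteq> q2" using not_in_R q1 q2 by auto
  ultimately show False using ne(1) d_eq by simp
qed

text \<open>The star at \<open>z\<close> on \<open>x\<close>, \<open>y\<close>, \<open>z1\<close>, \<open>z2\<close> would dominate with one edge too many.\<close>

lemma no_star:
  assumes x': "x' \<in> R" "x \<sim> x'" and y': "y' \<in> R" "y \<sim> y'"
    and z1: "z1 \<in> R" "z \<sim> z1" and z2: "z2 \<in> R" "z \<sim> z2"
    and e: "x' \<sim> z1" "y' \<sim> z2" and ne: "z1 \<noteq> z2" and nadj: "\<not> x' \<sim> y'"
  shows False
proof -
  let ?K = "{x', z1, y', z2}"
  have ne': "x' \<noteq> y'" "x' \<noteq> z1" "x' \<noteq> z2" "y' \<noteq> z1" "y' \<noteq> z2"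
    using no_common_nbr x' y' z1 z2 by blast+
  have nR: "x \<notin> {x', y', z1, z2}" "y \<notin> {x', y', z1, z2}" "z \<notin> {x', y', z1, z2}"
    using not_in_R x' y' z1 z2 by auto
  have "pm {x', z1, y', z2}"
    using matchable_two_edges[OF e] ne ne' by auto
  then have W: "pm (R - ?K)" using rest_matchable x' y' z1 z2 by simp
  have "card {x', y'} + 1 = card {x, y, z1, z2} + d"
  proof (rule well_edge_dominated_star[OF simple wed equi W])
    show "V - (R - ?K) = insert z ({x, y, z1, z2} \<union> {x', y'})"
      using V_eq x' y' z1 z2 not_in_R by auto
    show "z \<notin> {x, y, z1, z2} \<union> {x', y'}" "{x, y, z1, z2} \<inter> {x', y'} = {}"
      using nR ne' distinct by auto
    show "z \<sim> w" if "w \<in> {x, y, z1, z2}" for w using that tri z1 z2 sym by auto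
    show "\<exists>u\<in>{x', y'}. w \<sim> u" if "w \<in> {x, y, z1, z2}" for w using that x' y' e sym by auto
    show "indep {x', y'}" using nadj sym by (auto simp: independent_def)
    show "\<not> z \<sim> u" if "u \<in> {x', y'}" for u using that no_common_nbr x' y' by auto
  qed simp
  moreover have "card {x, y, z1, z2} = 4" using nR ne distinct by auto
  ultimately show False using ne' d_eq by simp
qed

text \<open>\<open>path4_closes\<close> shortens every walk in \<open>R\<close> to length at most
  two.\<close>

lemma reach_close:
  assumes "reach a b" "a \<in> R"
  shows "a = b \<or> a \<sim> b \<or> (\<exists>p\<in>R. a \<sim> p \<and> p \<sim> b)"
  using assms
proof (induction rule: reach_induct)
  case (step r s)
  then consider "a = r" | "a \<sim> r" | p where "p \<in> R" "a \<sim> p" "p \<sim> r" by auto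
  then show ?case
  proof cases
    case 3
    then show ?thesis using path4_closes[OF assms(2) 3(1) step(1,2) 3(2,3) step(3)] step(3) by blast
  qed (use step in auto)
qed simp

section \<open>Recognising the crystal graph\<close>

lemma isomorphic_crystal:
  assumes V: "V = {t1, t2, t3, u1, u2, u3, u4}" "distinct [t1, t2, t3, u1, u2, u3, u4]"
    and e: "t1 \<sim> t2" "t2 \<sim> t3" "t3 \<sim> t1" "u1 \<sim> u2" "u2 \<sim> u3" "u3 \<sim> u4" "u4 \<sim> u1"
      "t1 \<sim> u2" "t2 \<sim> u1" "t3 \<sim> u4"
    and n: "\<not> t1 \<sim> u1" "\<not> t1 \<sim> u3" "\<not> t1 \<sim> u4" "\<not> t2 \<sim> u2" "\<not> t2 \<sim> u3" "\<not> t2 \<sim> u4"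
      "\<not> t3 \<sim> u1" "\<not> t3 \<sim> u2" "\<not> t3 \<sim> u3" "\<not> u1 \<sim> u3" "\<not> u2 \<sim> u4"
  shows "isomorphic G crystal"
proof -
  define f where "f = (\<lambda>v. if v = t1 then T1 else if v = t2 then T2 else if v = t3 then T3 else
    if v = u1 then U1 else if v = u2 then U2 else if v = u3 then U3 else U4)"
  have f: "f t1 = T1" "f t2 = T2" "f t3 = T3" "f u1 = U1" "f u2 = U2" "f u3 = U3" "f u4 = U4"
    using V(2) by (auto simp: f_def)
  have "UNIV = {T1, T2, T3, U1, U2, U3, U4}" using crystal_vertex.exhaust by auto
  then have "f ` V = UNIV" using f V(1) by simp
  moreover have "inj_on f V" using f V(1) by (auto simp: inj_on_def)
  ultimately have "bij_betw f V (verts crystal)" by (simp add: bij_betw_def crystal_def)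
  moreover have "u \<sim> v \<longleftrightarrow> adj crystal (f u) (f v)" if "u \<in> V" "v \<in> V" for u v
  proof -
    have e': "t2 \<sim> t1" "t3 \<sim> t2" "t1 \<sim> t3" "u2 \<sim> u1" "u3 \<sim> u2" "u4 \<sim> u3" "u1 \<sim> u4"
      "u2 \<sim> t1" "u1 \<sim> t2" "u4 \<sim> t3" using e sym by blast+
    have n': "\<not> u1 \<sim> t1" "\<not> u3 \<sim> t1" "\<not> u4 \<sim> t1" "\<not> u2 \<sim> t2" "\<not> u3 \<sim> t2" "\<not> u4 \<sim> t2"
      "\<not> u1 \<sim> t3" "\<not> u2 \<sim> t3" "\<not> u3 \<sim> t3" "\<not> u3 \<sim> u1" "\<not> u4 \<sim> u2" using n sym by blast+
    have "u \<in> {t1, t2, t3, u1, u2, u3, u4}" "v \<in> {t1, t2, t3, u1, u2, u3, u4}"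
      using that V(1) by auto
    \<comment> \<open>The ten edges and eleven non-edges settle all 21 pairs of distinct
      vertices.\<close>
    then show ?thesis
      unfolding insert_iff empty_iff
      by (elim disjE; simp add: f e e' n n'; simp add: adj_def crystal_def doubleton_eq_iff)
  qed
  ultimately show ?thesis unfolding isomorphic_def by blast
qed

text \<open>A common neighbour of \<open>x'\<close> and \<open>z'\<close> forces a four-cycle through \<open>x'\<close> and \<open>z'\<close> that is
  a component of \<open>R\<close>; \<open>two_edges_cover_y\<close> and its permutations then exclude other components.\<close>

lemma crystal_if_common_nbr:
  assumes x': "x' \<in> R" "x \<sim> x'" and z': "z' \<in> R" "z \<sim> z'"
    and p: "p \<in> R" "x' \<sim> p" "z' \<sim> p"
    and reach_nbr: "\<And>r. r \<in> R \<Longrightarrow> \<exists>w\<in>R. (x \<sim> w \<or> y \<sim> w \<or> z \<sim> w) \<and> reach r w"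
  shows "isomorphic G crystal"
proof -
  note cover_x = perfect_rest.two_edges_cover_y[OF swap_xy']
  note cover_z = perfect_rest.two_edges_cover_y[OF swap_yz']
  note cover_y' = perfect_rest.two_edges_cover_y[OF swap_xz']
  note no_star_y = perfect_rest.no_star[OF swap_yz']
  have ne: "x' \<noteq> z'" using no_common_nbr x' z' by auto
  have nadj: "\<not> x' \<sim> z'" using no_triangle[of x' p z'] p x' sym by metis
  have tf: "\<not> a \<sim> b" if "c \<in> R" "c \<sim> a" "c \<sim> b" for a b c using no_triangle that by metis
  have pp: "p \<noteq> x'" "p \<noteq> z'" using p by auto
  \<comment> \<open>Completing \<open>x'p\<close> to a perfect matching of \<open>R\<close> gives
    \<open>z'\<close> a partner \<open>q'\<close> other than \<open>p\<close>; the path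
    \<open>x'\<close>, \<open>p\<close>, \<open>z'\<close>, \<open>q'\<close> then closes to a
    four-cycle.\<close>
  have "pm (R - {x', p})" using rest_matchable matchable_pair[OF p(2)] x' p by simp
  moreover have "z' \<in> R - {x', p}" using z' ne pp by auto
  ultimately obtain q' where q': "q' \<in> R - {x', p}" "z' \<sim> q'" by (rule matchable_partner)
  have q'R: "q' \<in> R" "p \<noteq> q'" "q' \<noteq> x'" using q' by auto
  have xq': "x' \<sim> q'"
    using path4_closes[OF x'(1) p(1) z'(1) q'R(1) p(2)] p(3) q'(2) ne q'R(2) sym by metis
  have "y \<sim> p \<or> y \<sim> q'"
    using two_edges_cover_y[OF x' z' p(1,2) q'R(1) q'(2) q'R(2) pp(2) q'R(3)] tf[OF x'(1) p(2) xq'] by auto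
  \<comment> \<open>\<open>y1\<close> is one of \<open>p\<close>, \<open>q'\<close> that is adjacent
    to \<open>y\<close>, and \<open>q\<close> is the other.\<close>
  then obtain y1 q where y1: "y1 \<in> R" "y \<sim> y1" "x' \<sim> y1" "z' \<sim> y1"
    and q: "q \<in> R" "x' \<sim> q" "z' \<sim> q" "q \<noteq> y1"
    using p q'R q'(2) xq' by metis
  \<comment> \<open>A second common neighbour of \<open>y\<close> and \<open>z'\<close> would permit
    the star at \<open>y\<close> that \<open>no_star\<close> excludes.\<close>
  have only_y1: "s = y1" if "s \<in> R" "y \<sim> s" "z' \<sim> s" for s
    using no_star_y[OF x' z' y1(1,2) that(1,2) y1(3) that(3)] nadj by blast
  have nyq: "\<not> y \<sim> q" using only_y1 q by auto
  have both: "z' \<sim> s \<longleftrightarrow> x' \<sim> s" if "s \<in> R" for s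
    using path4_closes[OF z'(1) q(1) x'(1) that] path4_closes[OF x'(1) q(1) z'(1) that] q ne sym
    by metis
  \<comment> \<open>A third neighbour \<open>s\<close> of \<open>x'\<close> would contradict
    \<open>two_edges_cover_y\<close> for \<open>x'q\<close> and \<open>z's\<close>, since neither
    \<open>q\<close> nor \<open>s\<close> is adjacent to \<open>y\<close>.\<close>
  have Nx: "s = y1 \<or> s = q" if s: "s \<in> R" "x' \<sim> s" for s
  proof (rule ccontr)
    assume n: "\<not> (s = y1 \<or> s = q)"
    have "z' \<sim> s" using both s by blast
    then have "\<not> y \<sim> s" using only_y1 s n by auto
    moreover have "y \<sim> q \<or> y \<sim> s"
      by (rule two_edges_cover_y[OF x' z' q(1,2) s(1) \<open>z' \<sim> s\<close>])
        (use n s q tf[OF x'(1) q(2) s(2)] in auto)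
    ultimately show False using nyq by auto
  qed
  let ?K = "{x', y1, z', q}"
  have neK: "x' \<noteq> y1" "x' \<noteq> q" "z' \<noteq> y1" "z' \<noteq> q" using y1 q by auto
  have "pm {x', y1, z', q}"
    using matchable_two_edges[OF y1(3) q(3)] neK ne q(4) by auto
  then have pK: "pm (R - ?K)" using rest_matchable x' z' y1 q by simp
  \<comment> \<open>If \<open>s\<close> lay outside the cycle, so would its partner
    \<open>t\<close>, and the path \<open>x'\<close>, \<open>k\<close>, \<open>s\<close>,
    \<open>t\<close> would close and give \<open>x'\<close> a third neighbour.\<close>
  have closed: "s \<in> ?K" if k: "k \<in> ?K" and s: "s \<in> R" "k \<sim> s" for k s
  proof (rule ccontr)
    assume sK: "s \<notin> ?K"
    then have sR: "s \<in> R - ?K" using s by auto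
    obtain t where t: "t \<in> R - ?K" "s \<sim> t" using matchable_partner[OF pK sR] by metis
    have "k = y1 \<or> k = q" using k Nx both s sK by blast
    then have "x' \<sim> t"
      using path4_closes[OF x'(1) _ s(1), of k t] t s(2) sK y1 q by auto
    then show False using Nx t by auto
  qed
  \<comment> \<open>Otherwise there is an edge \<open>ws\<close> off the cycle with \<open>w\<close>
    adjacent to a corner. Paired with two edges of the cycle in turn, it forces \<open>s\<close> to
    be adjacent to both other corners.\<close>
  have "r \<in> ?K" if r: "r \<in> R" for r
  proof (rule ccontr)
    assume rK: "r \<notin> ?K"
    obtain w where w: "w \<in> R" "x \<sim> w \<or> y \<sim> w \<or> z \<sim> w" "reach r w" using reach_nbr[OF r] by auto
    from w(3) r have "w \<notin> ?K"
    proof (induction rule: reach_induct)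
      case (step a b)
      then show ?case using closed[of b a] sym by metis
    qed (rule rK)
    then have wK: "w \<in> R - ?K" using w(1) by auto
    obtain s where s: "s \<in> R - ?K" "w \<sim> s" using matchable_partner[OF pK wK] by metis
    have sR: "s \<in> R" using s by auto
    have nb: "\<not> k \<sim> s" "\<not> s \<sim> k" if "k \<in> ?K" for k
      using closed[OF that sR] s sym[of k s] by auto
    have y1': "y1 \<sim> x'" "y1 \<sim> z'" using y1 sym by blast+
    have ns: "k \<noteq> s" "k \<noteq> w" "s \<noteq> k" if "k \<in> ?K" for k using that s wK by auto
    have nx: "\<not> x \<sim> q" "\<not> z \<sim> q" "\<not> x \<sim> z'" "\<not> z \<sim> x'"
      using no_triangle[of x' x q] no_triangle[of z' z q] x' z' q no_common_nbr sym by metis+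
    from w(2) show False
    proof (elim disjE)
      assume xw: "x \<sim> w"
      have "y \<sim> q \<or> y \<sim> s"
        by (rule cover_y'[OF z' w(1) xw q(1,3) sR s(2)]) (use nb ns in auto)
      moreover have "z \<sim> x' \<or> z \<sim> s"
        by (rule perfect_rest.two_edges_cover_y[OF perfect_rest.swap_yz'[OF swap_xy'] y1(1,2) w(1) xw
              x'(1) y1'(1) sR s(2)]) (use nb ns in auto)
      ultimately show False using nyq nx no_common_nbr(3)[OF sR] by blast
    next
      assume yw: "y \<sim> w"
      have "z \<sim> q \<or> z \<sim> s"
        by (rule cover_z[OF x' w(1) yw q(1,2) sR s(2)]) (use nb ns in auto)
      moreover have "x \<sim> q \<or> x \<sim> s"
        by (rule perfect_rest.two_edges_cover_y[OF perfect_rest.swap_yz'[OF swap_xz'] z' w(1) yw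
              q(1,3) sR s(2)]) (use nb ns in auto)
      ultimately show False using nx no_common_nbr(2)[OF sR] by blast
    next
      assume zw: "z \<sim> w"
      have "y \<sim> q \<or> y \<sim> s"
        by (rule two_edges_cover_y[OF x' w(1) zw q(1,2) sR s(2)]) (use nb ns in auto)
      moreover have "x \<sim> z' \<or> x \<sim> s"
        by (rule cover_x[OF y1(1,2) w(1) zw z'(1) y1'(2) sR s(2)]) (use nb ns in auto)
      ultimately show False using nyq nx no_common_nbr(1)[OF sR] by blast
    qed
  qed
  then have RK: "R = ?K" using x' z' y1 q by auto
  show ?thesis
  proof (rule isomorphic_crystal[of x y z y1 x' q z'])
    show "V = {x, y, z, y1, x', q, z'}" using V_eq RK by auto
    show "distinct [x, y, z, y1, x', q, z']"
      using distinct neK ne q not_in_R x' y1 z' by auto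
  qed (use tri x' z' y1 q nyq nadj no_common_nbr[OF x'(1)] no_common_nbr[OF y1(1)]
      no_common_nbr[OF z'(1)] tf[OF x'(1) y1(3) q(2)] no_triangle[of x' x q] no_triangle[of z' z q]
      sym in \<open>metis+\<close>)
qed

text \<open>If no two neighbours of different corners had a common neighbour in \<open>R\<close>,
  \<open>reach_close\<close> would make \<open>x'z1\<close> and \<open>y'z2\<close> edges with
  \<open>z1\<close>, \<open>z2\<close> distinct and \<open>x'\<close>, \<open>y'\<close> not
  adjacent, which \<open>no_star\<close> excludes.\<close>

lemma crystal:
  assumes reach_z: "\<And>r. r \<in> R \<Longrightarrow> \<exists>z'\<in>R. z \<sim> z' \<and> reach r z'"
  shows "isomorphic G crystal"
proof -
  have rx: "\<exists>w\<in>R. (x \<sim> w \<or> y \<sim> w \<or> z \<sim> w) \<and> reach r w" if "r \<in> R" for r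
    using reach_z[OF that] by auto
  have ry: "\<exists>w\<in>R. (y \<sim> w \<or> x \<sim> w \<or> z \<sim> w) \<and> reach r w"
    "\<exists>w\<in>R. (x \<sim> w \<or> z \<sim> w \<or> y \<sim> w) \<and> reach r w" if "r \<in> R" for r
    using reach_z[OF that] by auto
  note xz = crystal_if_common_nbr
  note yz = perfect_rest.crystal_if_common_nbr[OF swap_xy']
  note xy = perfect_rest.crystal_if_common_nbr[OF swap_yz']
  obtain x' y' where x': "x' \<in> R" "x \<sim> x'" and y': "y' \<in> R" "y \<sim> y'" using nbr by auto
  obtain z1 where z1: "z1 \<in> R" "z \<sim> z1" "reach x' z1" using reach_z x' by blast
  obtain z2 where z2: "z2 \<in> R" "z \<sim> z2" "reach y' z2" using reach_z y' by blast
  have ne: "x' \<noteq> z1" "y' \<noteq> z2" using no_common_nbr x' y' z1 z2 by blast+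
  show ?thesis
  proof (rule ccontr)
    assume n: "\<not> isomorphic G crystal"
    have a1: "x' \<sim> z1"
      using reach_close[OF z1(3) x'(1)] ne(1) xz[OF x' z1(1,2) _ _ _ rx] n sym by metis
    have a2: "y' \<sim> z2"
      using reach_close[OF z2(3) y'(1)] ne(2) yz[OF y' z2(1,2) _ _ _ ry(1)] n sym by metis
    have "z1 \<noteq> z2" using xy[OF x' y' z1(1) a1 _ ry(2)] a2 n by blast
    moreover have "\<not> x' \<sim> y'"
      using yz[OF y' z1(1,2) x'(1) _ _ ry(1)] a1 n sym by metis
    ultimately show False using no_star[OF x' y' z1(1,2) z2(1,2) a1 a2] by blast
  qed
qed

end

section \<open>From the stated hypotheses to the locales\<close>

lemma triangleI:
  assumes "adj G a b" "adj G b c" "adj G a c" "simple_graph G"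
  shows "triangle \<lparr>verts = {a, b, c}, edges = {{a, b}, {b, c}, {a, c}}\<rparr> G"
proof -
  let ?T = "\<lparr>verts = {a, b, c}, edges = {{a, b}, {b, c}, {a, c}}\<rparr>"
  have ne: "a \<noteq> b" "b \<noteq> c" "a \<noteq> c" using assms adj_irrefl by metis+
  have "subgraph ?T G"
    using assms adj_verts[OF assms(4)] ne by (auto simp: subgraph_def simple_graph_def adj_def)
  moreover have "isomorphic ?T (complete_graph 3)"
  proof -
    define f :: "'a \<Rightarrow> nat" where "f = (\<lambda>v. if v = a then 0 else if v = b then 1 else 2)"
    have f: "f a = 0" "f b = 1" "f c = 2" using ne by (auto simp: f_def)
    have "{..<3::nat} = {0, 1, 2}" by auto
    then have "bij_betw f (verts ?T) (verts (complete_graph 3))"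
      using f ne by (auto simp: bij_betw_def inj_on_def complete_graph_def)
    moreover have "adj (complete_graph 3) i j \<longleftrightarrow> i < 3 \<and> j < 3 \<and> i \<noteq> j" for i j
      by (auto simp: adj_def complete_graph_def doubleton_eq_iff)
    then have "adj ?T u v \<longleftrightarrow> adj (complete_graph 3) (f u) (f v)"
      if "u \<in> {a, b, c}" "v \<in> {a, b, c}" for u v
      using that f ne by (auto simp: adj_def doubleton_eq_iff)
    ultimately show ?thesis unfolding isomorphic_def by auto
  qed
  ultimately show ?thesis by (simp add: triangle_def)
qed

lemma degree_ge_3_other_neighbour:
  assumes "simple_graph G" "degree G v \<ge> 3"
  shows "\<exists>a\<in>verts G - {v, p, q}. adj G v a"
proof (rule ccontr)
  assume "\<not> (\<exists>a\<in>verts G - {v, p, q}. adj G v a)"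
  then have "{u. adj G v u} \<subseteq> {p, q}"
    using adj_verts[OF assms(1)] adj_irrefl[OF assms(1)] by blast
  then have "degree G v \<le> card {p, q}" unfolding degree_def by (intro card_mono) auto
  also have "\<dots> \<le> 2" by (simp add: card_insert_if)
  finally show False using assms(2) by simp
qed

theorem theorem10:
  fixes G :: "'a graph" and x y z :: 'a
  assumes "simple_graph G"
    and "connected G"
    and "well_edge_dominated G"
    and "{T. triangle T G} = {\<lparr>verts = {x, y, z}, edges = {{x, y}, {y, z}, {x, z}}\<rparr>}"
    and "\<exists>!C. component C (delete_verts G {x, y}) \<and> nontrivial C"
    and "degree G x \<ge> 3" and "degree G y \<ge> 3" and "degree G z \<ge> 3"
  shows "isomorphic G crystal"
proof -
  obtain d where d: "equimatchable G (verts G) d"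
    using well_edge_dominated_equimatchable[OF assms(1,3)] .
  define R where "R = verts G - {x, y, z}"
  have eq: "{y, x, z} = {x, y, z}" "{z, x, y} = {x, y, z}" by auto
  interpret unique_triangle G x y z R d
  proof
    have "triangle \<lparr>verts = {x, y, z}, edges = {{x, y}, {y, z}, {x, z}}\<rparr> G" using assms(4) by blast
    then show "adj G x y" "adj G y z" "adj G x z" by (auto simp: triangle_def subgraph_def adj_def)
    show "{a, b, c} = {x, y, z}" if "adj G a b" "adj G b c" "adj G a c" for a b c
    proof -
      have "\<lparr>verts = {a, b, c}, edges = {{a, b}, {b, c}, {a, c}}\<rparr> \<in> {T. triangle T G}"
        using triangleI[OF that assms(1)] by blast
      then show ?thesis unfolding assms(4) by simp
    qed
    show "\<exists>a\<in>R. adj G x a" "\<exists>a\<in>R. adj G y a" "\<exists>a\<in>R. adj G z a"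
      using degree_ge_3_other_neighbour[OF assms(1,6), of y z] eq
        degree_ge_3_other_neighbour[OF assms(1,7), of x z]
        degree_ge_3_other_neighbour[OF assms(1,8), of x y] by (simp_all add: R_def)
  qed (use assms(1) d R_def in auto)
  note reach_z = reach_z_nbr[OF assms(2,5)]
  \<comment> \<open>The component hypothesis acts twice through \<open>reach_z\<close>: here it
    excludes missable vertices, below it locates the crystal.\<close>
  interpret perfect_rest G x y z R d
    by unfold_locales (use nothing_miss[OF reach_z] assms(3) in auto)
  show ?thesis by (rule crystal[OF reach_z])
qed

end
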